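(* Let $n\ge 3$. Let $\xi:R_3\times R_3\to R_3$ be the bilinear map given on basis elements by $$\xi(e_1,x)=e_1,\qquad \xi(e_i,x)=(i-2)e_i\ (3\le i\le n),\qquad \xi(x,e_1)=-e_1,$$ all other values on pairs of basis elements being zero. Then the class $\overline{\xi}$ forms a basis of $HL^2(R_3,R_3)$.
   Context: A Leibniz algebra over $\mathbb{C}$ is a complex vector space $L$ with a bilinear bracket satisfying $[x,[y,z]]=[[x,y],z]-[[x,z],y]$. For a Leibniz algebra $L$, $ZL^2(L,L)$ is the space of bilinear maps $\varphi:L\times L\to L$ such that for all $x,y,z\in L$ $$[x,\varphi(y,z)]-[\varphi(x,y),z]+[\varphi(x,z),y]+\varphi(x,[y,z])-\varphi([x,y],z)+\varphi([x,z],y)=0;$$ $BL^2(L,L)$ is the space of maps of the form $f(x,y)=[d(x),y]+[x,d(y)]-d([x,y])$ for some linear map $d:L\to L$; and $HL^2(L,L)=ZL^2(L,L)/BL^2(L,L)$. The bar denotes the class in $HL^2$. $R_3$ has basis $\{e_1,\dots,e_n,x\}$ and products (omitted products are zero): $[e_i,e_1]=e_{i+1}$ for $2\le i\le n-1$; $[x,e_1]=-e_1$; $[e_1,x]=e_1$; $[e_i,x]=(i-n)e_i$ for $2\le i\le n$; $[x,x]=e_n$. *)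

theory Defs
  imports Complex_Main "HOL-Algebra.AbelCoset" "Jordan_Normal_Form.VS_Connect"
begin

section \<open>Quotient modules\<close>

text \<open>
  The quotient of a module by a submodule, on the additive cosets of HOL-Algebra. For a submodule
  \<open>H\<close> the union in the scalar multiplication is over equal cosets, and the fields \<open>mult\<close> and \<open>one\<close>
  (inherited from the ring record) play no role for modules.
\<close>

definition quotient_module ::
  "('a, 'b, 'c) module_scheme \<Rightarrow> 'b set \<Rightarrow> ('a, 'b set) module" where
  "quotient_module M H =
    \<lparr>carrier = a_rcosets\<^bsub>M\<^esub> H,
     mult = (\<lambda>_ _. H),
     one = H,
     zero = H,
     add = (\<lambda>X Y. X <+>\<^bsub>M\<^esub> Y),
     smult = (\<lambda>a X. \<Union>v\<in>X. H +>\<^bsub>M\<^esub> (a \<odot>\<^bsub>M\<^esub> v))\<rparr>"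

lemma (in Module.module) quotient_smult:
  assumes H: "Module.submodule H R M" and a: "a \<in> carrier R" and v: "v \<in> carrier M"
  shows "(\<Union>w\<in>H +>\<^bsub>M\<^esub> v. H +>\<^bsub>M\<^esub> (a \<odot>\<^bsub>M\<^esub> w)) = H +>\<^bsub>M\<^esub> (a \<odot>\<^bsub>M\<^esub> v)"
proof -
  interpret abelian_subgroup H M
    by (intro abelian_subgroupI3 additive_subgroup.intro Module.submodule.axioms(1)[OF H])
      (rule M.abelian_group_axioms)
  have "H +>\<^bsub>M\<^esub> (a \<odot>\<^bsub>M\<^esub> w) = H +>\<^bsub>M\<^esub> (a \<odot>\<^bsub>M\<^esub> v)" if w: "w \<in> H +>\<^bsub>M\<^esub> v" for w
  proof -
    from w obtain h where h: "h \<in> H" and w_eq: "w = h \<oplus>\<^bsub>M\<^esub> v"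
      unfolding a_r_coset_def' by auto
    have hM: "h \<in> carrier M" using h by (rule a_Hcarr)
    have "a \<odot>\<^bsub>M\<^esub> w = (a \<odot>\<^bsub>M\<^esub> h) \<oplus>\<^bsub>M\<^esub> (a \<odot>\<^bsub>M\<^esub> v)"
      using w_eq smult_r_distr[OF a hM v] by simp
    moreover have "a \<odot>\<^bsub>M\<^esub> h \<in> H" using Module.submodule.smult_closed[OF H a h] .
    ultimately have "a \<odot>\<^bsub>M\<^esub> w \<in> H +>\<^bsub>M\<^esub> (a \<odot>\<^bsub>M\<^esub> v)"
      unfolding a_r_coset_def' by auto
    thus ?thesis
      using a_repr_independence'[OF _ smult_closed[OF a v]] by simp
  qed
  moreover have "v \<in> H +>\<^bsub>M\<^esub> v" using a_rcos_self[OF v] .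
  ultimately show ?thesis by blast
qed

lemma (in Module.module) module_quotient:
  assumes H: "Module.submodule H R M"
  shows "Module.module R (quotient_module M H)"
proof -
  interpret S: abelian_subgroup H M
    by (intro abelian_subgroupI3 additive_subgroup.intro Module.submodule.axioms(1)[OF H])
      (rule M.abelian_group_axioms)
  let ?Q = "quotient_module M H"
  have carr: "carrier ?Q = (\<lambda>v. H +>\<^bsub>M\<^esub> v) ` carrier M"
    unfolding quotient_module_def A_RCOSETS_def' by auto
  have add: "(H +>\<^bsub>M\<^esub> v) \<oplus>\<^bsub>?Q\<^esub> (H +>\<^bsub>M\<^esub> w) = H +>\<^bsub>M\<^esub> (v \<oplus>\<^bsub>M\<^esub> w)"
    if "v \<in> carrier M" "w \<in> carrier M" for v w
    unfolding quotient_module_def using S.a_rcos_sum[OF that] by simp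
  have smult: "a \<odot>\<^bsub>?Q\<^esub> (H +>\<^bsub>M\<^esub> v) = H +>\<^bsub>M\<^esub> (a \<odot>\<^bsub>M\<^esub> v)"
    if "a \<in> carrier R" "v \<in> carrier M" for a v
    unfolding quotient_module_def using quotient_smult[OF H that] by simp
  have zero: "\<zero>\<^bsub>?Q\<^esub> = H +>\<^bsub>M\<^esub> \<zero>\<^bsub>M\<^esub>"
    unfolding quotient_module_def using a_coset_add_zero[OF S.a_subset] by simp
  have "abelian_group ?Q"
  proof (rule abelian_groupI)
    fix X assume "X \<in> carrier ?Q"
    then obtain v where "v \<in> carrier M" "X = H +>\<^bsub>M\<^esub> v" by (auto simp: carr)
    thus "\<exists>Y\<in>carrier ?Q. Y \<oplus>\<^bsub>?Q\<^esub> X = \<zero>\<^bsub>?Q\<^esub>"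
      by (intro bexI[of _ "H +>\<^bsub>M\<^esub> (\<ominus>\<^bsub>M\<^esub> v)"]) (auto simp: carr add zero M.l_neg)
  qed (auto simp: carr add zero M.a_ac)
  thus ?thesis
  proof (intro moduleI R.cring_axioms)
  qed (auto simp: carr add smult smult_l_distr smult_r_distr smult_assoc1)
qed


section \<open>Leibniz algebras and their second cohomology\<close>

definition bilinear_map :: "(complex \<Rightarrow> 'v \<Rightarrow> 'v) \<Rightarrow> ('v::ab_group_add \<Rightarrow> 'v \<Rightarrow> 'v) \<Rightarrow> bool" where
  "bilinear_map scale \<phi> \<longleftrightarrow>
    (\<forall>u. Vector_Spaces.linear scale scale (\<phi> u)) \<and>
    (\<forall>v. Vector_Spaces.linear scale scale (\<lambda>u. \<phi> u v))"

locale leibniz_algebra = vector_space scale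
  for scale :: "complex \<Rightarrow> 'v::ab_group_add \<Rightarrow> 'v" +
  fixes br :: "'v \<Rightarrow> 'v \<Rightarrow> 'v"
  assumes bilinear_br: "bilinear_map scale br"
    and leibniz: "br u (br v w) = br (br u v) w - br (br u w) v"

text \<open>The bilinear maps on a vector space, as a HOL-Algebra module.\<close>

definition CL2 :: "(complex \<Rightarrow> 'v \<Rightarrow> 'v) \<Rightarrow> (complex, 'v::ab_group_add \<Rightarrow> 'v \<Rightarrow> 'v) module" where
  "CL2 scale =
    \<lparr>carrier = {\<phi>. bilinear_map scale \<phi>},
     mult = (\<lambda>_ _ _ _. 0),
     one = (\<lambda>_ _. 0),
     zero = (\<lambda>_ _. 0),
     add = (\<lambda>\<phi> \<psi> u v. \<phi> u v + \<psi> u v),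
     smult = (\<lambda>a \<phi> u v. scale a (\<phi> u v))\<rparr>"

definition ZL2 ::
  "(complex \<Rightarrow> 'v \<Rightarrow> 'v) \<Rightarrow> ('v \<Rightarrow> 'v \<Rightarrow> 'v) \<Rightarrow> ('v::ab_group_add \<Rightarrow> 'v \<Rightarrow> 'v) set" where
  "ZL2 scale br =
    {\<phi>. bilinear_map scale \<phi> \<and>
      (\<forall>u v w. br u (\<phi> v w) - br (\<phi> u v) w + br (\<phi> u w) v
        + \<phi> u (br v w) - \<phi> (br u v) w + \<phi> (br u w) v = 0)}"

definition BL2 ::
  "(complex \<Rightarrow> 'v \<Rightarrow> 'v) \<Rightarrow> ('v \<Rightarrow> 'v \<Rightarrow> 'v) \<Rightarrow> ('v::ab_group_add \<Rightarrow> 'v \<Rightarrow> 'v) set" where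
  "BL2 scale br =
    {(\<lambda>u v. br (d u) v + br u (d v) - d (br u v)) | d. Vector_Spaces.linear scale scale d}"

definition ZL2_module ::
  "(complex \<Rightarrow> 'v \<Rightarrow> 'v) \<Rightarrow> ('v \<Rightarrow> 'v \<Rightarrow> 'v)
    \<Rightarrow> (complex, 'v::ab_group_add \<Rightarrow> 'v \<Rightarrow> 'v) module" where
  "ZL2_module scale br = CL2 scale\<lparr>carrier := ZL2 scale br\<rparr>"

definition HL2 ::
  "(complex \<Rightarrow> 'v \<Rightarrow> 'v) \<Rightarrow> ('v \<Rightarrow> 'v \<Rightarrow> 'v)
    \<Rightarrow> (complex, ('v::ab_group_add \<Rightarrow> 'v \<Rightarrow> 'v) set) module" where
  "HL2 scale br = quotient_module (ZL2_module scale br) (BL2 scale br)"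

definition HL2_class ::
  "(complex \<Rightarrow> 'v \<Rightarrow> 'v) \<Rightarrow> ('v \<Rightarrow> 'v \<Rightarrow> 'v) \<Rightarrow> ('v::ab_group_add \<Rightarrow> 'v \<Rightarrow> 'v)
    \<Rightarrow> ('v \<Rightarrow> 'v \<Rightarrow> 'v) set" where
  "HL2_class scale br \<phi> = BL2 scale br +>\<^bsub>ZL2_module scale br\<^esub> \<phi>"

lemma bilinear_map_iff:
  assumes "vector_space scale"
  shows "bilinear_map scale \<phi> \<longleftrightarrow>
    (\<forall>u v w. \<phi> (u + v) w = \<phi> u w + \<phi> v w) \<and> (\<forall>u v w. \<phi> u (v + w) = \<phi> u v + \<phi> u w) \<and>
    (\<forall>a u v. \<phi> (scale a u) v = scale a (\<phi> u v)) \<and> (\<forall>a u v. \<phi> u (scale a v) = scale a (\<phi> u v))"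
  unfolding bilinear_map_def using assms
  by (auto simp: Vector_Spaces.linear_iff)

lemma module_CL2:
  assumes "vector_space scale"
  shows "Module.module class_ring (CL2 scale)"
proof (rule moduleI)
  interpret vector_space scale by fact
  show "cring (class_ring :: complex ring)" by (rule class_cring.cring_axioms)
  have bl: "bilinear_map scale \<phi> \<longleftrightarrow>
    (\<forall>u v w. \<phi> (u + v) w = \<phi> u w + \<phi> v w) \<and> (\<forall>u v w. \<phi> u (v + w) = \<phi> u v + \<phi> u w) \<and>
    (\<forall>a u v. \<phi> (scale a u) v = scale a (\<phi> u v)) \<and> (\<forall>a u v. \<phi> u (scale a v) = scale a (\<phi> u v))"
    for \<phi>
    by (rule bilinear_map_iff) (rule vector_space_axioms)
  show "abelian_group (CL2 scale)"
  proof (rule abelian_groupI)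
    fix \<phi> assume "\<phi> \<in> carrier (CL2 scale)"
    thus "\<exists>\<psi>\<in>carrier (CL2 scale). \<psi> \<oplus>\<^bsub>CL2 scale\<^esub> \<phi> = \<zero>\<^bsub>CL2 scale\<^esub>"
      by (intro bexI[of _ "\<lambda>u v. - \<phi> u v"]) (auto simp: CL2_def bl)
  qed (auto simp: CL2_def bl scale_right_distrib algebra_simps)
qed (auto simp: CL2_def bilinear_map_iff[OF assms] vector_space.vector_space_assms[OF assms] algebra_simps)

lemma ex_bilinear_map:
  fixes scale :: "complex \<Rightarrow> 'v::ab_group_add \<Rightarrow> 'v"
  assumes "vector_space scale" and fin: "finite B"
    and indep: "\<not> module.dependent scale B" and span: "module.span scale B = UNIV"
  shows "\<exists>\<phi>. bilinear_map scale \<phi> \<and> (\<forall>b\<in>B. \<forall>c\<in>B. \<phi> b c = f b c)"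
proof -
  interpret vector_space scale by fact
  define r where "r = representation B"
  have r: "r (u + v) b = r u b + r v b" "r (scale a u) b = a * r u b" for u v a b
    unfolding r_def using indep span by (auto simp: representation_add representation_scale)
  have r_basis: "r b c = (if c = b then 1 else 0)" if "b \<in> B" for b c
    unfolding r_def using representation_basis[OF indep that] by (simp add: eq_commute)
  define \<phi> where "\<phi> u v = (\<Sum>b\<in>B. \<Sum>c\<in>B. scale (r u b * r v c) (f b c))" for u v
  have "bilinear_map scale \<phi>"
    by (auto simp: bilinear_map_iff[OF vector_space_axioms] \<phi>_def r ring_distribs
        scale_left_distrib sum.distrib scale_sum_right mult_ac)
  moreover have "\<phi> b c = f b c" if "b \<in> B" "c \<in> B" for b c
  proof -
    have "\<phi> b c = (\<Sum>b'\<in>B. \<Sum>c'\<in>B. if b' = b then if c' = c then f b' c' else 0 else 0)"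
      unfolding \<phi>_def by (intro sum.cong refl) (auto simp: r_basis that)
    also have "\<dots> = (\<Sum>b'\<in>B. if b' = b then f b' c else 0)"
      using fin that by (intro sum.cong refl) (auto simp: sum.delta)
    also have "\<dots> = f b c" using fin that by (simp add: sum.delta)
    finally show ?thesis .
  qed
  ultimately show ?thesis by blast
qed

lemma (in leibniz_algebra) submodule_ZL2: "Module.submodule (ZL2 scale br) class_ring (CL2 scale)"
proof -
  interpret C: Module.module class_ring "CL2 scale" by (rule module_CL2[OF vector_space_axioms])
  have bl: "br (u + v) w = br u w + br v w" "br u (v + w) = br u v + br u w"
    "br (scale a u) v = scale a (br u v)" "br u (scale a v) = scale a (br u v)" for a u v w
    using bilinear_br by (auto simp: bilinear_map_iff[OF vector_space_axioms])
  have add: "\<phi> \<oplus>\<^bsub>CL2 scale\<^esub> \<psi> \<in> ZL2 scale br"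
    if "\<phi> \<in> ZL2 scale br" "\<psi> \<in> ZL2 scale br" for \<phi> \<psi>
  proof -
    have eq: "br u (\<phi> v w + \<psi> v w) - br (\<phi> u v + \<psi> u v) w + br (\<phi> u w + \<psi> u w) v
        + (\<phi> u (br v w) + \<psi> u (br v w)) - (\<phi> (br u v) w + \<psi> (br u v) w)
        + (\<phi> (br u w) v + \<psi> (br u w) v) =
      (br u (\<phi> v w) - br (\<phi> u v) w + br (\<phi> u w) v + \<phi> u (br v w) - \<phi> (br u v) w + \<phi> (br u w) v) +
      (br u (\<psi> v w) - br (\<psi> u v) w + br (\<psi> u w) v + \<psi> u (br v w) - \<psi> (br u v) w + \<psi> (br u w) v)"
      for u v w by (simp add: bl)
    show ?thesis using that C.a_closed[of \<phi> \<psi>]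
      unfolding ZL2_def by (auto simp: CL2_def eq)
  qed
  have smult: "a \<odot>\<^bsub>CL2 scale\<^esub> \<phi> \<in> ZL2 scale br" if "\<phi> \<in> ZL2 scale br" for a \<phi>
  proof -
    have eq: "br u (scale a (\<phi> v w)) - br (scale a (\<phi> u v)) w + br (scale a (\<phi> u w)) v
        + scale a (\<phi> u (br v w)) - scale a (\<phi> (br u v) w) + scale a (\<phi> (br u w) v) =
      scale a (br u (\<phi> v w) - br (\<phi> u v) w + br (\<phi> u w) v
        + \<phi> u (br v w) - \<phi> (br u v) w + \<phi> (br u w) v)"
      for u v w by (simp add: bl scale_right_distrib scale_right_diff_distrib)
    show ?thesis using that C.smult_closed[of a \<phi>]
      unfolding ZL2_def by (auto simp: CL2_def eq)
  qed
  have sub: "ZL2 scale br \<subseteq> carrier (CL2 scale)"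
    by (auto simp: ZL2_def CL2_def)
  have zero: "\<zero>\<^bsub>CL2 scale\<^esub> \<in> ZL2 scale br"
    using C.zero_closed bl(3)[of 0] bl(4)[of _ 0] by (auto simp: ZL2_def CL2_def)
  have inv: "\<ominus>\<^bsub>CL2 scale\<^esub> \<phi> \<in> ZL2 scale br" if "\<phi> \<in> ZL2 scale br" for \<phi>
  proof -
    have "\<ominus>\<^bsub>CL2 scale\<^esub> \<phi> = (-1) \<odot>\<^bsub>CL2 scale\<^esub> \<phi>"
      using that sub smult[OF that, of "-1"]
      by (intro C.minus_equality) (auto simp: CL2_def)
    thus ?thesis using smult[OF that] by simp
  qed
  show ?thesis
    by (rule C.submoduleI) (use sub zero inv add smult in auto)
qed

lemma (in leibniz_algebra) module_ZL2: "Module.module class_ring (ZL2_module scale br)"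
  unfolding ZL2_module_def
  by (rule Module.submodule.submodule_is_module[OF submodule_ZL2 module_CL2[OF vector_space_axioms]])

lemma (in leibniz_algebra) submodule_BL2:
  "Module.submodule (BL2 scale br) class_ring (ZL2_module scale br)"
proof -
  interpret Z: Module.module class_ring "ZL2_module scale br" by (rule module_ZL2)
  have bl: "br (u + v) w = br u w + br v w" "br u (v + w) = br u v + br u w"
    "br (scale a u) v = scale a (br u v)" "br u (scale a v) = scale a (br u v)" for a u v w
    using bilinear_br by (auto simp: bilinear_map_iff[OF vector_space_axioms])
  have bl_diff: "br (u - v) w = br u w - br v w" "br u (v - w) = br u v - br u w" for u v w
    using bl(1)[of "u - v" v w] bl(2)[of u "v - w" w] by auto
  have lin: "Vector_Spaces.linear scale scale d \<longleftrightarrow>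
      (\<forall>u v. d (u + v) = d u + d v) \<and> (\<forall>a u. d (scale a u) = scale a (d u))" for d
    using vector_space_axioms by (auto simp: Vector_Spaces.linear_iff)
  have sub: "BL2 scale br \<subseteq> carrier (ZL2_module scale br)"
  proof
    fix f assume "f \<in> BL2 scale br"
    then obtain d where d: "Vector_Spaces.linear scale scale d"
      and f: "f = (\<lambda>u v. br (d u) v + br u (d v) - d (br u v))" by (auto simp: BL2_def)
    have da: "d (u + v) = d u + d v" "d (scale a u) = scale a (d u)" for a u v
      using d by (auto simp: lin)
    have dd: "d (u - v) = d u - d v" for u v using da(1)[of "u - v" v] by simp
    have "bilinear_map scale f"
      by (auto simp: bilinear_map_iff[OF vector_space_axioms] f bl da
          scale_right_distrib scale_right_diff_distrib)
    moreover have "br u (f v w) - br (f u v) w + br (f u w) v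
        + f u (br v w) - f (br u v) w + f (br u w) v = 0" for u v w
      by (simp add: f bl bl_diff da dd leibniz)
    ultimately show "f \<in> carrier (ZL2_module scale br)"
      by (simp add: ZL2_module_def ZL2_def)
  qed
  have add: "\<phi> \<oplus>\<^bsub>ZL2_module scale br\<^esub> \<psi> \<in> BL2 scale br"
    if "\<phi> \<in> BL2 scale br" "\<psi> \<in> BL2 scale br" for \<phi> \<psi>
  proof -
    from that obtain d d' where d: "Vector_Spaces.linear scale scale d" "Vector_Spaces.linear scale scale d'"
      and eq: "\<phi> = (\<lambda>u v. br (d u) v + br u (d v) - d (br u v))"
        "\<psi> = (\<lambda>u v. br (d' u) v + br u (d' v) - d' (br u v))" by (auto simp: BL2_def)
    show ?thesis unfolding BL2_def
      using d by (intro CollectI exI[of _ "\<lambda>u. d u + d' u"])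
        (auto simp: fun_eq_iff lin eq ZL2_module_def CL2_def bl scale_right_distrib)
  qed
  have smult: "a \<odot>\<^bsub>ZL2_module scale br\<^esub> \<phi> \<in> BL2 scale br" if "\<phi> \<in> BL2 scale br" for a \<phi>
  proof -
    from that obtain d where d: "Vector_Spaces.linear scale scale d"
      and eq: "\<phi> = (\<lambda>u v. br (d u) v + br u (d v) - d (br u v))" by (auto simp: BL2_def)
    show ?thesis unfolding BL2_def
      using d by (intro CollectI exI[of _ "\<lambda>u. scale a (d u)"])
        (auto simp: fun_eq_iff lin eq ZL2_module_def CL2_def bl scale_right_distrib
          scale_right_diff_distrib mult.commute)
  qed
  have zero: "\<zero>\<^bsub>ZL2_module scale br\<^esub> \<in> BL2 scale br"
    unfolding BL2_def using bl(3)[of 0] bl(4)[of _ 0]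
    by (intro CollectI exI[of _ "\<lambda>u. 0"]) (auto simp: lin ZL2_module_def CL2_def)
  have inv: "\<ominus>\<^bsub>ZL2_module scale br\<^esub> \<phi> \<in> BL2 scale br" if "\<phi> \<in> BL2 scale br" for \<phi>
  proof -
    have "\<ominus>\<^bsub>ZL2_module scale br\<^esub> \<phi> = (-1) \<odot>\<^bsub>ZL2_module scale br\<^esub> \<phi>"
      using that sub smult[OF that, of "-1"]
      by (intro Z.minus_equality) (auto simp: ZL2_module_def CL2_def)
    thus ?thesis using smult[OF that] by simp
  qed
  show ?thesis
    by (rule Z.submoduleI) (use sub zero inv add smult in auto)
qed

theorem (in leibniz_algebra) vectorspace_HL2: "vectorspace class_ring (HL2 scale br)"
  unfolding HL2_def
  by (intro vectorspace.intro module.module_quotient[OF module_ZL2 submodule_BL2])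
    (rule class_field.field_axioms)


section \<open>The algebra \<open>R\<^sub>3\<close>\<close>

text \<open>
  \<open>R\<^sub>3\<close> is given by a vector space with a chosen basis \<open>e 1, \<dots>, e n, x\<close>; the values of \<open>e\<close> outside
  \<open>{1..n}\<close> are irrelevant. The Leibniz identity follows from the multiplication table for \<open>n \<ge> 2\<close>
  (lemma \<open>leibniz_algebra_R3\<close>) and is therefore not assumed.
\<close>

locale algebra_R3 = vector_space scale
  for scale :: "complex \<Rightarrow> 'v::ab_group_add \<Rightarrow> 'v" +
  fixes br :: "'v \<Rightarrow> 'v \<Rightarrow> 'v" and n :: nat and e :: "nat \<Rightarrow> 'v" and x :: 'v
  assumes inj_e: "inj_on e {1..n}"
    and x_notin: "x \<notin> e ` {1..n}"
    and independent_basis: "independent (insert x (e ` {1..n}))"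
    and span_basis: "span (insert x (e ` {1..n})) = UNIV"
    and bilinear_br: "bilinear_map scale br"
    and br_e_e: "\<And>i j. i \<in> {1..n} \<Longrightarrow> j \<in> {1..n} \<Longrightarrow>
      br (e i) (e j) = (if j = 1 \<and> 2 \<le> i \<and> i \<le> n - 1 then e (i + 1) else 0)"
    and br_x_e: "\<And>j. j \<in> {1..n} \<Longrightarrow> br x (e j) = (if j = 1 then - e 1 else 0)"
    and br_e_x: "\<And>i. i \<in> {1..n} \<Longrightarrow>
      br (e i) x = (if i = 1 then e 1 else scale (of_nat i - of_nat n) (e i))"
    and br_x_x: "br x x = e n"

lemma (in algebra_R3) leibniz_algebra_R3:
  assumes n: "2 \<le> n"
  shows "leibniz_algebra scale br"
proof -
  have bl: "br (u + v) w = br u w + br v w" "br u (v + w) = br u v + br u w"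
    "br (scale a u) v = scale a (br u v)" "br u (scale a v) = scale a (br u v)" for a u v w
    using bilinear_br by (auto simp: bilinear_map_iff[OF vector_space_axioms])
  have bl0: "br 0 v = 0" "br u 0 = 0" "br (- u) v = - br u v" "br u (- v) = - br u v" for u v
    using bl(3)[of 0 0 v] bl(4)[of u 0 0] bl(3)[of "-1" u v] bl(4)[of u "-1" v] by auto
  let ?B = "insert x (e ` {1..n})"
  let ?P = "\<lambda>u v w. br u (br v w) = br (br u v) w - br (br u w) v"
  have e_e: "br (e i) (e j) = (if j = 1 \<and> 2 \<le> i \<and> i < n then e (i + 1) else 0)"
    if "1 \<le> i" "i \<le> n" "1 \<le> j" "j \<le> n" for i j
    using that br_e_e[of i j] by auto
  have x_e: "br x (e j) = (if j = 1 then - e 1 else 0)" if "1 \<le> j" "j \<le> n" for j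
    using that br_x_e[of j] by auto
  have e_x: "br (e i) x = (if i = 1 then e 1 else scale (of_nat i - of_nat n) (e i))"
    if "1 \<le> i" "i \<le> n" for i
    using that br_e_x[of i] by auto
  have bl_diff: "br (u - v) w = br u w - br v w" "br u (v - w) = br u v - br u w" for u v w
    using bl(1)[of "u - v" v w] bl(2)[of u "v - w" w] by auto
  note table = e_e x_e e_x br_x_x bl bl0 bl_diff
  have basis: "?P u v w" if "u \<in> ?B" "v \<in> ?B" "w \<in> ?B" for u v w
  proof -
    have c: "z \<in> ?B \<Longrightarrow> z = x \<or> (\<exists>i. 1 \<le> i \<and> i \<le> n \<and> z = e i)" for z by auto
    note [simp] = table scale_left_diff_distrib scale_left_distrib
    have eee: "?P (e i) (e j) (e k)" if "1 \<le> i" "i \<le> n" "1 \<le> j" "j \<le> n" "1 \<le> k" "k \<le> n" for i j k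
      using that n by simp
    have eex: "?P (e i) (e j) x" if "1 \<le> i" "i \<le> n" "1 \<le> j" "j \<le> n" for i j
      using that n by simp
    have exe: "?P (e i) x (e j)" if "1 \<le> i" "i \<le> n" "1 \<le> j" "j \<le> n" for i j
      using that n by simp
    have xee: "?P x (e i) (e j)" if "1 \<le> i" "i \<le> n" "1 \<le> j" "j \<le> n" for i j
      using that n by simp
    have exx: "?P (e i) x x" if "1 \<le> i" "i \<le> n" for i
      using that n by simp
    have xex: "?P x (e i) x" if "1 \<le> i" "i \<le> n" for i
      using that n by simp
    have xxe: "?P x x (e i)" if "1 \<le> i" "i \<le> n" for i
      using that n by simp
    have xxx: "?P x x x" using n by simp
    from c[OF that(1)] c[OF that(2)] c[OF that(3)] show ?thesis
      using eee eex exe xee exx xex xxe xxx by (elim disjE exE conjE; hypsubst)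
  qed
  have ext: "P u"
    if "\<And>b. b \<in> ?B \<Longrightarrow> P b" "subspace {u. P u}" for P u
    using span_induct[of u ?B P] that span_basis by auto
  have 1: "?P u v w" if "v \<in> ?B" "w \<in> ?B" for u v w
    by (rule ext[of "\<lambda>u. ?P u v w"])
      (use that basis in \<open>auto simp: subspace_def bl bl0 scale_right_diff_distrib\<close>)
  have 2: "?P u v w" if "w \<in> ?B" for u v w
    by (rule ext[of "\<lambda>v. ?P u v w"])
      (use that 1 in \<open>auto simp: subspace_def bl bl0 scale_right_diff_distrib\<close>)
  have 3: "?P u v w" for u v w
    by (rule ext[of "\<lambda>w. ?P u v w"])
      (use 2 in \<open>auto simp: subspace_def bl bl0 scale_right_diff_distrib\<close>)
  show ?thesis
    using bilinear_br 3 by unfold_locales auto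
qed

text \<open>Every complex vector space with a basis of \<open>n + 1\<close> elements carries the structure of \<open>R\<^sub>3\<close>.\<close>

lemma ex_algebra_R3:
  fixes scale :: "complex \<Rightarrow> 'v::ab_group_add \<Rightarrow> 'v"
  assumes "vector_space scale" and inj: "inj_on e {1..n}" and x: "x \<notin> e ` {1..n}"
    and indep: "\<not> module.dependent scale (insert x (e ` {1..n}))"
    and span: "module.span scale (insert x (e ` {1..n})) = UNIV"
  shows "\<exists>br. algebra_R3 scale br n e x"
proof -
  interpret vector_space scale by fact
  define ix where "ix = inv_into {1..n} e"
  have ix: "ix (e i) = i" if "i \<in> {1..n}" for i
    unfolding ix_def using inj that by (rule inv_into_f_f)
  define f where "f b c =
    (if b = x then if c = x then e n else if ix c = 1 then - e 1 else 0
     else if c = x then if ix b = 1 then e 1 else scale (of_nat (ix b) - of_nat n) b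
     else if ix c = 1 \<and> 2 \<le> ix b \<and> ix b \<le> n - 1 then e (ix b + 1) else 0)" for b c
  obtain br where br: "bilinear_map scale br"
    and tab: "\<And>b c. b \<in> insert x (e ` {1..n}) \<Longrightarrow> c \<in> insert x (e ` {1..n}) \<Longrightarrow> br b c = f b c"
    using ex_bilinear_map[OF vector_space_axioms _ indep span, of f] by auto
  have ne: "e i \<noteq> x" if "i \<in> {1..n}" for i using x that by blast
  have "algebra_R3 scale br n e x"
    by unfold_locales
      (use inj x indep span br in \<open>simp_all add: tab f_def ix ne\<close>)
  thus ?thesis by blast
qed

end

theory Submission
  imports Defs
begin

text \<open>
  Right multiplication by each of \<open>e 2, \<dots>, e n\<close> vanishes; their span \<open>N\<close> (the tail) is the
  right annihilator of the algebra. Write \<open>A\<close>, \<open>D\<close> for right multiplication by \<open>e 1\<close>, \<open>x\<close>.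
  Polarising the cocycle identity gives \<open>\<phi> u (e i) = br u g\<^sub>i\<close> for \<open>i \<ge> 2\<close>, so a
  coboundary removes these values, and a second one makes \<open>p u = \<phi> u (e 1)\<close> and
  \<open>q u = \<phi> u x\<close> take values in \<open>N\<close>. The whole cocycle identity is then
  \<open>q A - A q + D p - p D = p\<close>. Subtracting the coboundary of a map determined recursively along
  the chain \<open>e 2, \<dots>, e n\<close> gives \<open>p = 0\<close> and \<open>q = c\<close> on \<open>N\<close>. A multiple of \<open>\<xi>\<close> absorbs the scalar
  \<open>c\<close>, and since \<open>D\<close> has no positive integer eigenvalue on \<open>N\<close>, what is left is a coboundary.
  Conversely, if \<open>\<xi>\<close> were the coboundary of \<open>d\<close>, then comparing the values at \<open>(x, e n)\<close> and
  \<open>(e n, x)\<close> would give \<open>n - 2 = 0\<close>.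
\<close>

declare One_nat_def [simp del]

text \<open>One nonzero vector is independent because the empty set spans only zero. This reduces
  the theorem to two facts: \<open>\<xi>\<close> is no coboundary, and every cocycle is cohomologous
  to a multiple of it.\<close>

lemma (in vectorspace) basis_singletonI:
  assumes v: "v \<in> carrier V" "v \<noteq> \<zero>\<^bsub>V\<^esub>"
    and gen: "\<And>w. w \<in> carrier V \<Longrightarrow> \<exists>c\<in>carrier K. w = c \<odot>\<^bsub>V\<^esub> v"
  shows "basis {v}"
proof -
  have "lin_indpt ({} \<union> {v})"
    using v by (subst lin_dep_iff_in_span[symmetric]) (auto simp: lin_dep_def span_empty)
  moreover have "carrier V \<subseteq> span {v}"
  proof
    fix w assume "w \<in> carrier V"
    then obtain c where c: "c \<in> carrier K" "w = c \<odot>\<^bsub>V\<^esub> v" using gen by blast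
    hence "w = lincomb (\<lambda>_. c) {v}" using v by (simp add: lincomb_def)
    thus "w \<in> span {v}" using c by (auto simp: span_def)
  qed
  ultimately show ?thesis
    using v span_is_subset2[of "{v}"] by (auto simp: basis_def)
qed

section \<open>Coordinates, and maps prescribed on the basis\<close>

context algebra_R3
begin

definition basis_set :: "'v set" where
  "basis_set = insert x (e ` {1..n})"

lemma independent_basis_set: "independent basis_set" and span_basis_set: "span basis_set = UNIV"
  using independent_basis span_basis by (simp_all add: basis_set_def)

lemma representation_basis_set:
  "b \<in> basis_set \<Longrightarrow> representation basis_set b c = (if c = b then 1 else 0)"
  by (simp add: representation_basis[OF independent_basis_set] eq_commute)

text \<open>Index \<open>0\<close> stands for \<open>x\<close>, so a vector becomes a tuple indexed
  by \<open>0..n\<close> and identities can be checked one coordinate at a time.\<close>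

definition co :: "nat \<Rightarrow> 'v \<Rightarrow> complex" where
  "co i u = representation basis_set u (if i = 0 then x else e i)"

definition in_tail :: "'v \<Rightarrow> bool" where
  "in_tail u \<longleftrightarrow> co 0 u = 0 \<and> co 1 u = 0"

lemma linear_iff':
  "Vector_Spaces.linear scale scale d \<longleftrightarrow>
    (\<forall>u v. d (u + v) = d u + d v) \<and> (\<forall>a u. d (scale a u) = scale a (d u))"
  using vector_space_axioms by (auto simp: Vector_Spaces.linear_iff)

lemma basis_induct:
  assumes "P x" "\<And>i. 1 \<le> i \<Longrightarrow> i \<le> n \<Longrightarrow> P (e i)"
    and "\<And>u v. P u \<Longrightarrow> P v \<Longrightarrow> P (u + v)" "\<And>a u. P u \<Longrightarrow> P (scale a u)"
  shows "P u"
proof -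
  \<comment> \<open>The zero vector is covered as \<open>scale 0 x\<close>.\<close>
  have "subspace {u. P u}"
    using assms(3,4) assms(4)[of x 0] assms(1) by (auto simp: subspace_def)
  moreover have "P b" if "b \<in> basis_set" for b using that assms(1,2) by (auto simp: basis_set_def)
  ultimately show ?thesis using span_induct[of u basis_set P] span_basis_set by auto
qed

lemma co_linear [simp]:
  "co i (u + v) = co i u + co i v" "co i (scale a u) = a * co i u" "co i 0 = 0"
  "co i (u - v) = co i u - co i v" "co i (- u) = - co i u"
  using independent_basis_set span_basis_set
  by (auto simp: co_def representation_add representation_scale representation_zero
      representation_diff representation_neg)

lemma co_sum: "co i (sum f S) = (\<Sum>s\<in>S. co i (f s))"
  using independent_basis_set span_basis_set by (simp add: co_def representation_sum)

lemma x_mem: "x \<in> basis_set" and e_mem: "1 \<le> i \<Longrightarrow> i \<le> n \<Longrightarrow> e i \<in> basis_set"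
  by (auto simp: basis_set_def)

lemma co_x [simp]: "j \<le> n \<Longrightarrow> co j x = (if j = 0 then 1 else 0)"
proof -
  assume "j \<le> n"
  hence "j \<noteq> 0 \<Longrightarrow> e j \<noteq> x" using x_notin by force
  thus ?thesis by (simp add: co_def representation_basis_set x_mem)
qed

lemma co_e [simp]: "1 \<le> i \<Longrightarrow> i \<le> n \<Longrightarrow> j \<le> n \<Longrightarrow> co j (e i) = (if j = i then 1 else 0)"
proof -
  assume i: "1 \<le> i" "i \<le> n" and j: "j \<le> n"
  have "e i \<noteq> x" "j \<noteq> 0 \<Longrightarrow> e j = e i \<longleftrightarrow> j = i"
    using x_notin inj_on_eq_iff[OF inj_e, of j i] i j by auto
  with i show ?thesis by (auto simp: co_def representation_basis_set e_mem)
qed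

lemma expand: "u = scale (co 0 u) x + (\<Sum>i = 1..n. scale (co i u) (e i))"
proof (induction u rule: basis_induct)
  case 1
  have "(\<Sum>i = 1..n. scale (co i x) (e i)) = 0" by (intro sum.neutral) auto
  then show ?case by simp
next
  case (2 k)
  have "(\<Sum>i = 1..n. scale (co i (e k)) (e i)) = (\<Sum>i = 1..n. if i = k then e i else 0)"
    using 2 by (intro sum.cong) auto
  with 2 show ?case by simp
next
  case (3 u v)
  have "scale (co 0 (u + v)) x + (\<Sum>i = 1..n. scale (co i (u + v)) (e i))
      = (scale (co 0 u) x + (\<Sum>i = 1..n. scale (co i u) (e i)))
      + (scale (co 0 v) x + (\<Sum>i = 1..n. scale (co i v) (e i)))"
    by (simp add: scale_left_distrib sum.distrib)
  also have "\<dots> = u + v" using 3 by metis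
  finally show ?case by (rule sym)
next
  case (4 a u)
  have "scale (co 0 (scale a u)) x + (\<Sum>i = 1..n. scale (co i (scale a u)) (e i))
      = scale a (scale (co 0 u) x + (\<Sum>i = 1..n. scale (co i u) (e i)))"
    by (simp add: scale_right_distrib scale_sum_right)
  also have "\<dots> = scale a u" using 4 by metis
  finally show ?case by (rule sym)
qed

lemma vec_eqI:
  assumes "\<And>j. j \<le> n \<Longrightarrow> co j u = co j v"
  shows "u = v"
proof -
  have "scale (co 0 u) x + (\<Sum>i = 1..n. scale (co i u) (e i))
      = scale (co 0 v) x + (\<Sum>i = 1..n. scale (co i v) (e i))"
    using assms by (intro arg_cong2[where f = "(+)"] sum.cong) auto
  thus ?thesis using expand[of u] expand[of v] by simp
qed

lemma ex_vec: "\<exists>u. \<forall>j\<le>n. co j u = f j"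
proof -
  have "co j (scale (f 0) x + (\<Sum>i = 1..n. scale (f i) (e i))) = f j" if "j \<le> n" for j
  proof -
    have "(\<Sum>i = 1..n. f i * co j (e i)) = (\<Sum>i = 1..n. if i = j then f i else 0)"
      using that by (intro sum.cong) auto
    with that show ?thesis by (cases "j = 0") (simp_all add: co_sum)
  qed
  thus ?thesis by blast
qed

lemma ex_linear:
  "\<exists>d. Vector_Spaces.linear scale scale d \<and> d x = y \<and> (\<forall>i\<in>{1..n}. d (e i) = f i)"
proof -
  define d where "d u = scale (co 0 u) y + (\<Sum>i = 1..n. scale (co i u) (f i))" for u
  have "d (e k) = f k" if "k \<in> {1..n}" for k
  proof -
    have "(\<Sum>i = 1..n. scale (co i (e k)) (f i)) = (\<Sum>i = 1..n. if i = k then f i else 0)"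
      using that by (intro sum.cong) auto
    with that show ?thesis by (simp add: d_def)
  qed
  moreover have "d x = y"
  proof -
    have "(\<Sum>i = 1..n. scale (co i x) (f i)) = 0" by (intro sum.neutral) auto
    then show ?thesis by (simp add: d_def)
  qed
  moreover have "Vector_Spaces.linear scale scale d"
    by (simp add: linear_iff' d_def scale_left_distrib scale_right_distrib sum.distrib
        scale_sum_right algebra_simps)
  ultimately show ?thesis by blast
qed

lemma bilinear_simps:
  assumes "bilinear_map scale \<phi>"
  shows "\<phi> (u + v) w = \<phi> u w + \<phi> v w" "\<phi> u (v + w) = \<phi> u v + \<phi> u w"
    "\<phi> (scale a u) v = scale a (\<phi> u v)" "\<phi> u (scale a v) = scale a (\<phi> u v)"
    "\<phi> (- u) v = - \<phi> u v" "\<phi> u (- v) = - \<phi> u v"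
    "\<phi> (u - v) w = \<phi> u w - \<phi> v w" "\<phi> u (v - w) = \<phi> u v - \<phi> u w"
    "\<phi> 0 v = 0" "\<phi> u 0 = 0"
proof -
  have add: "\<phi> (u + v) w = \<phi> u w + \<phi> v w" "\<phi> u (v + w) = \<phi> u v + \<phi> u w" for u v w
    using assms by (auto simp: bilinear_map_iff[OF vector_space_axioms])
  show "\<phi> (u + v) w = \<phi> u w + \<phi> v w" "\<phi> u (v + w) = \<phi> u v + \<phi> u w" by (fact add)+
  show "\<phi> (scale a u) v = scale a (\<phi> u v)" "\<phi> u (scale a v) = scale a (\<phi> u v)"
    using assms by (auto simp: bilinear_map_iff[OF vector_space_axioms])
  show diff: "\<phi> (u - v) w = \<phi> u w - \<phi> v w" "\<phi> u (v - w) = \<phi> u v - \<phi> u w" for u v w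
    using add(1)[of "u - v" v w] add(2)[of u "v - w" w] by auto
  show "\<phi> 0 v = 0" "\<phi> u 0 = 0" "\<phi> (- u) v = - \<phi> u v" "\<phi> u (- v) = - \<phi> u v"
    using diff(1)[of 0 0 v] diff(2)[of u 0 0] diff(1)[of 0 u v] diff(2)[of u 0 v] by auto
qed

lemmas br_bilinear = bilinear_simps[OF bilinear_br]

lemma br_tail [simp]: "2 \<le> j \<Longrightarrow> j \<le> n \<Longrightarrow> br u (e j) = 0"
  by (induction u rule: basis_induct) (auto simp: br_e_e br_x_e br_bilinear)

end

section \<open>Right multiplications and the tail\<close>

locale algebra_R3_ge3 = algebra_R3 scale br n e x
  for scale :: "complex \<Rightarrow> 'v::ab_group_add \<Rightarrow> 'v" and br n e x +
  assumes n3: "3 \<le> n"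
begin

lemma n_bounds [simp]:
  "1 \<le> n" "2 \<le> n" "n \<noteq> 0" "n \<noteq> 1" "n \<noteq> 2" "n - 1 \<noteq> n" "\<not> n \<le> n - 1"
  using n3 by auto

lemma n2_nonzero [simp]: "(of_nat n :: complex) \<noteq> 2" "(of_nat n - 2 :: complex) \<noteq> 0"
proof -
  show "(of_nat n :: complex) \<noteq> 2" using of_nat_eq_iff[where 'a = complex, of n 2] by simp
  thus "(of_nat n - 2 :: complex) \<noteq> 0" by simp
qed

text \<open>Right multiplication by \<open>e 1\<close> shifts the chain
  \<open>e 2, ..., e n\<close>, so coordinate \<open>j\<close> comes from \<open>j - 1\<close>; this
  starts at \<open>3\<close> because nothing is sent to \<open>e 2\<close>.\<close>

lemma co_br_e1 [simp]:
  "j \<le> n \<Longrightarrow> co j (br u (e 1)) = (if j = 1 then - co 0 u else if 3 \<le> j then co (j - 1) u else 0)"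
  by (induction u rule: basis_induct) (use n3 in \<open>auto simp: br_e_e br_x_e br_bilinear\<close>)

lemma co_br_x [simp]:
  "j \<le> n \<Longrightarrow> co j (br u x) = (if j = 0 then 0 else if j = 1 then co 1 u
    else (of_nat j - of_nat n) * co j u + (if j = n then co 0 u else 0))"
  by (induction u rule: basis_induct) (use n3 in \<open>auto simp: br_e_x br_x_x br_bilinear algebra_simps\<close>)

text \<open>Such a map sees only the \<open>e 1\<close> and \<open>x\<close> coordinates of its
  second argument, so it amounts to the pair \<open>p\<close>, \<open>q\<close>.\<close>

lemma bilinear_tail_eq:
  assumes "bilinear_map scale \<phi>" and tail: "\<And>u i. 2 \<le> i \<Longrightarrow> i \<le> n \<Longrightarrow> \<phi> u (e i) = 0"
  shows "\<phi> u v = scale (co 1 v) (\<phi> u (e 1)) + scale (co 0 v) (\<phi> u x)"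
proof (induction v rule: basis_induct)
  case (2 i)
  with tail[of i] show ?case by (cases "i = 1") (auto simp: bilinear_simps[OF assms(1)])
qed (auto simp: bilinear_simps[OF assms(1)] scale_left_distrib scale_right_distrib)

lemma br_eq: "br u v = scale (co 1 v) (br u (e 1)) + scale (co 0 v) (br u x)"
  by (intro bilinear_tail_eq bilinear_br br_tail)

lemma co_br:
  "j \<le> n \<Longrightarrow> co j (br u v) =
    co 1 v * (if j = 1 then - co 0 u else if 3 \<le> j then co (j - 1) u else 0) +
    co 0 v * (if j = 0 then 0 else if j = 1 then co 1 u
      else (of_nat j - of_nat n) * co j u + (if j = n then co 0 u else 0))"
  by (subst br_eq) simp

lemma in_tail_iff: "in_tail v \<longleftrightarrow> (\<forall>u. br u v = 0)"
proof
  assume "in_tail v"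
  thus "\<forall>u. br u v = 0" by (auto simp: br_eq[of _ v] in_tail_def)
next
  assume "\<forall>u. br u v = 0"
  \<comment> \<open>Testing against \<open>x\<close> suffices: coordinates \<open>1\<close> and
    \<open>n\<close> of \<open>br x v\<close> are \<open>- co 1 v\<close> and
    \<open>co 0 v\<close>.\<close>
  hence "br x v = 0" by blast
  hence "co 1 (br x v) = 0" "co n (br x v) = 0" by simp_all
  thus "in_tail v" by (simp add: co_br in_tail_def split: if_splits)
qed

lemma br_in_tail [simp]: "in_tail v \<Longrightarrow> br u v = 0"
  by (simp add: in_tail_iff)

lemma in_tail_simps [simp]:
  "in_tail 0" "in_tail u \<Longrightarrow> in_tail v \<Longrightarrow> in_tail (u + v)" "in_tail u \<Longrightarrow> in_tail v \<Longrightarrow> in_tail (u - v)"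
  "in_tail (- u) \<longleftrightarrow> in_tail u" "in_tail u \<Longrightarrow> in_tail (scale a u)"
  "in_tail u \<Longrightarrow> in_tail (br u v)" "2 \<le> i \<Longrightarrow> i \<le> n \<Longrightarrow> in_tail (e i)"
  by (auto simp: in_tail_def co_br)

text \<open>On the span of \<open>e 2, \<dots>, e n\<close> right multiplication by \<open>x\<close> has only the eigenvalues \<open>i - n \<le> 0\<close>.\<close>

lemma tail_eigenvector_zero:
  assumes "in_tail w" "br w x = scale (of_nat m) w" "0 < m"
  shows "w = 0"
proof (rule vec_eqI)
  fix j assume j: "j \<le> n"
  have "(of_nat j - of_nat n) * co j w = of_nat m * co j w" if "2 \<le> j"
    using arg_cong[OF assms(2), of "co j"] assms(1) j that by (auto simp: in_tail_def split: if_splits)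
  moreover have "(of_nat j - of_nat n :: complex) \<noteq> of_nat m"
  proof
    assume "(of_nat j - of_nat n :: complex) = of_nat m"
    hence "(of_nat j :: complex) = of_nat (n + m)" by (simp add: algebra_simps)
    thus False using j assms(3) unfolding of_nat_eq_iff by simp
  qed
  ultimately show "co j w = co j 0"
    using assms(1) by (cases "2 \<le> j"; cases "j = 0"; cases "j = 1") (auto simp: in_tail_def)
qed

section \<open>Cocycles and coboundaries\<close>

definition cob :: "('v \<Rightarrow> 'v) \<Rightarrow> 'v \<Rightarrow> 'v \<Rightarrow> 'v" where
  "cob d u v = br (d u) v + br u (d v) - d (br u v)"

lemma BL2_iff: "\<phi> \<in> BL2 scale br \<longleftrightarrow> (\<exists>d. Vector_Spaces.linear scale scale d \<and> \<phi> = cob d)"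
  by (auto simp: BL2_def cob_def fun_eq_iff)

lemma cob_ZL2: "Vector_Spaces.linear scale scale d \<Longrightarrow> cob d \<in> ZL2 scale br"
proof -
  assume d: "Vector_Spaces.linear scale scale d"
  interpret L: leibniz_algebra scale br by (rule leibniz_algebra_R3) simp
  interpret Z: Module.module class_ring "ZL2_module scale br" by (rule L.module_ZL2)
  have "BL2 scale br \<subseteq> carrier (ZL2_module scale br)"
    using L.submodule_BL2 by (rule Z.submoduleE(1))
  moreover have "cob d \<in> BL2 scale br" using d by (auto simp: BL2_iff)
  ultimately show "cob d \<in> ZL2 scale br" by (auto simp: ZL2_module_def)
qed

lemma ZL2_bilinear: "\<phi> \<in> ZL2 scale br \<Longrightarrow> bilinear_map scale \<phi>"
  by (simp add: ZL2_def)

lemma ZL2D: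
  "\<phi> \<in> ZL2 scale br \<Longrightarrow> br u (\<phi> v w) - br (\<phi> u v) w + br (\<phi> u w) v
    + \<phi> u (br v w) - \<phi> (br u v) w + \<phi> (br u w) v = 0"
  by (simp add: ZL2_def)

lemma ZL2_diff:
  assumes "\<phi> \<in> ZL2 scale br" "\<psi> \<in> ZL2 scale br"
  shows "(\<lambda>u v. \<phi> u v - \<psi> u v) \<in> ZL2 scale br"
proof -
  note bil = assms[THEN ZL2_bilinear]
  have "bilinear_map scale (\<lambda>u v. \<phi> u v - \<psi> u v)"
    unfolding bilinear_map_iff[OF vector_space_axioms]
    by (simp add: bilinear_simps[OF bil(1)] bilinear_simps[OF bil(2)] scale_right_diff_distrib)
  moreover have "br u (\<phi> v w - \<psi> v w) - br (\<phi> u v - \<psi> u v) w + br (\<phi> u w - \<psi> u w) v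
    + (\<phi> u (br v w) - \<psi> u (br v w)) - (\<phi> (br u v) w - \<psi> (br u v) w)
    + (\<phi> (br u w) v - \<psi> (br u w) v) = 0" for u v w
    using arg_cong2[OF ZL2D[OF assms(1), of u v w] ZL2D[OF assms(2), of u v w], of "(-)"]
    by (simp add: br_bilinear algebra_simps)
  ultimately show ?thesis by (simp add: ZL2_def)
qed

lemma ZL2_scale:
  assumes "\<phi> \<in> ZL2 scale br"
  shows "(\<lambda>u v. scale a (\<phi> u v)) \<in> ZL2 scale br"
proof -
  interpret L: leibniz_algebra scale br by (rule leibniz_algebra_R3) simp
  have "a \<odot>\<^bsub>CL2 scale\<^esub> \<phi> \<in> ZL2 scale br"
    using assms Module.submodule.smult_closed[OF L.submodule_ZL2, of a \<phi>] by simp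
  thus ?thesis by (simp add: CL2_def)
qed

lemma linear_simps:
  assumes "Vector_Spaces.linear scale scale d"
  shows "d (u + v) = d u + d v" "d (scale a u) = scale a (d u)" "d 0 = 0" "d (- u) = - d u"
    "d (u - v) = d u - d v"
proof -
  show add: "d (u + v) = d u + d v" and smult: "d (scale a u) = scale a (d u)" for u v a
    using assms by (auto simp: linear_iff')
  show "d 0 = 0" using add[of 0 0] by simp
  show "d (- u) = - d u" using smult[of "-1" u] by simp
  show "d (u - v) = d u - d v" using add[of "u - v" v] by simp
qed

lemma obtain_linear:
  obtains d where "Vector_Spaces.linear scale scale d" "d x = y"
    "\<And>i. 1 \<le> i \<Longrightarrow> i \<le> n \<Longrightarrow> d (e i) = f i"
  using ex_linear[of y f] by auto

text \<open>The terms in which \<open>u\<close> is first combined with \<open>v\<close> or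
  \<open>w\<close> are antisymmetric in \<open>v\<close> and \<open>w\<close>, so they cancel when
  the two instances of the identity are added.\<close>

lemma ZL2_polarized:
  assumes "\<phi> \<in> ZL2 scale br"
  shows "br u (\<phi> v w + \<phi> w v) + \<phi> u (br v w + br w v) = 0"
  using arg_cong2[OF ZL2D[OF assms, of u v w] ZL2D[OF assms, of u w v], of "(+)"]
  by (simp add: br_bilinear bilinear_simps[OF ZL2_bilinear[OF assms]] algebra_simps)

lemma scale_two: "scale 2 u = u + u"
  using scale_left_distrib[of 1 1 u] by simp

lemma br_e1_e: "1 \<le> i \<Longrightarrow> i \<le> n \<Longrightarrow> br (e i) (e 1) = (if 2 \<le> i \<and> i < n then e (i + 1) else 0)"
  using br_e_e[of i 1] by auto

lemma br_e1_x [simp]: "br (e 1) x = e 1"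
  using br_e_x[of 1] by simp

lemma br_e_x': "2 \<le> i \<Longrightarrow> i \<le> n \<Longrightarrow> br (e i) x = scale (of_nat i - of_nat n) (e i)"
  using br_e_x[of i] by simp

lemma br_x_e1 [simp]: "br x (e 1) = - e 1"
  using br_x_e[of 1] by simp

lemmas br_basis = br_e1_e br_e_x' br_x_x br_bilinear

text \<open>When \<open>\<phi> x (e 1)\<close> lies in the tail, the first term vanishes and this is
  the relation \<open>q A - A q + D p - p D = p\<close>.\<close>

lemma ZL2_x_e1:
  assumes "\<phi> \<in> ZL2 scale br"
  shows "br u (\<phi> x (e 1)) - br (\<phi> u x) (e 1) + br (\<phi> u (e 1)) x
    - \<phi> u (e 1) - \<phi> (br u x) (e 1) + \<phi> (br u (e 1)) x = 0"
  using ZL2D[OF assms, of u x "e 1"] by (simp add: bilinear_simps[OF ZL2_bilinear[OF assms]])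

text \<open>Only the four pairs formed from \<open>e 1\<close> and \<open>x\<close> are left. An
  explicit \<open>d\<close> removes the values with second argument \<open>x\<close>; those with
  second argument \<open>e 1\<close> then are eigenvectors for the eigenvalues 2 and 1 of right
  multiplication by \<open>x\<close>, hence zero.\<close>

lemma coboundary_of_zero_on_tail:
  assumes \<phi>: "\<phi> \<in> ZL2 scale br" and tail: "\<And>u i. 2 \<le> i \<Longrightarrow> i \<le> n \<Longrightarrow> \<phi> u (e i) = 0"
    and zero: "\<And>i. 2 \<le> i \<Longrightarrow> i \<le> n \<Longrightarrow> \<phi> (e i) (e 1) = 0" "\<And>i. 2 \<le> i \<Longrightarrow> i \<le> n \<Longrightarrow> \<phi> (e i) x = 0"
    and in_tail: "in_tail (\<phi> (e 1) (e 1))" "in_tail (\<phi> (e 1) x)"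
      "in_tail (\<phi> x (e 1))" "in_tail (\<phi> x x)"
  shows "\<exists>d. Vector_Spaces.linear scale scale d \<and> \<phi> = cob d"
proof -
  obtain y where y: "\<And>j. j \<le> n \<Longrightarrow> co j y =
      (if j < 2 then 0 else co j (\<phi> (e 1) x) / (of_nat j - of_nat n - 1))"
    using ex_vec[of "\<lambda>j. if j < 2 then 0 else co j (\<phi> (e 1) x) / (of_nat j - of_nat n - 1)"] by blast
  obtain z where z: "\<And>j. j \<le> n \<Longrightarrow> co j z =
      (if j < 2 \<or> j = n then 0 else co j (\<phi> x x) / (of_nat j - of_nat n))"
    using ex_vec[of "\<lambda>j. if j < 2 \<or> j = n then 0 else co j (\<phi> x x) / (of_nat j - of_nat n)"] by blast
  \<comment> \<open>\<open>y\<close> and \<open>z\<close> solve \<open>br y x - y = \<phi> (e 1) x\<close> and \<open>br z x = \<phi> x x\<close>, the latter only modulo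
    the span of \<open>e n\<close>, the kernel of right multiplication by \<open>x\<close> on the tail; \<open>c\<close> accounts for the remainder.\<close>
  define c where "c = - co n (\<phi> x x)"
  obtain d where d: "Vector_Spaces.linear scale scale d" "d x = z"
    "\<And>i. 1 \<le> i \<Longrightarrow> i \<le> n \<Longrightarrow> d (e i) = (if i = 1 then y else scale c (e i))"
    using obtain_linear[of z "\<lambda>i. if i = 1 then y else scale c (e i)"] by blast
  have yz [simp]: "in_tail y" "in_tail z" using y z by (auto simp: in_tail_def)
  note d_simps = d linear_simps[OF d(1)]
  define \<psi> where "\<psi> u v = \<phi> u v - cob d u v" for u v
  have \<psi>: "\<psi> \<in> ZL2 scale br"
    unfolding \<psi>_def using \<phi> cob_ZL2[OF d(1)] by (rule ZL2_diff)
  note bil = bilinear_simps[OF ZL2_bilinear[OF \<psi>]]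
  have tail': "\<psi> u (e i) = 0" if "2 \<le> i" "i \<le> n" for u i
    using that tail[OF that] by (simp add: \<psi>_def cob_def d_simps br_bilinear)
  have zero': "\<psi> (e i) (e 1) = 0" "\<psi> (e i) x = 0" if "2 \<le> i" "i \<le> n" for i
    using that zero[OF that] by (auto simp: \<psi>_def cob_def d_simps br_basis mult.commute)
  \<comment> \<open>Keeps the denominators in \<open>y\<close> away from zero.\<close>
  have nonzero: "(of_nat j :: complex) \<noteq> of_nat n + 1" if "j \<le> n" for j
    using that of_nat_eq_iff[where 'a = complex, of j "Suc n"] by auto
  have e1x: "\<psi> (e 1) x = 0"
  proof (rule vec_eqI)
    fix j assume j: "j \<le> n"
    have *: "\<psi> (e 1) x = \<phi> (e 1) x - (br y x - y)"
      by (simp add: \<psi>_def cob_def d_simps)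
    show "co j (\<psi> (e 1) x) = co j 0"
      using j in_tail(2) nonzero[OF j] by (auto simp: * co_br y in_tail_def field_simps)
  qed
  have xx: "\<psi> x x = 0"
  proof (rule vec_eqI)
    fix j assume j: "j \<le> n"
    have *: "\<psi> x x = \<phi> x x - (br z x - scale c (e n))"
      by (simp add: \<psi>_def cob_def d_simps br_basis)
    show "co j (\<psi> x x) = co j 0"
      using j in_tail(4) by (auto simp: * co_br z c_def in_tail_def field_simps)
  qed
  have e1e1: "\<psi> (e 1) (e 1) = 0"
  proof (rule tail_eigenvector_zero)
    show "in_tail (\<psi> (e 1) (e 1))"
      using in_tail by (simp add: \<psi>_def cob_def d_simps br_basis)
    have "in_tail (\<psi> x (e 1))"
      using in_tail by (simp add: \<psi>_def cob_def d_simps br_basis)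
    \<comment> \<open>One summand is the term \<open>- \<psi> u (e 1)\<close> of the relation at
      \<open>u = e 1\<close>, the other comes from \<open>br (e 1) x = e 1\<close>.\<close>
    hence "br (\<psi> (e 1) (e 1)) x = \<psi> (e 1) (e 1) + \<psi> (e 1) (e 1)"
      using ZL2_x_e1[OF \<psi>, of "e 1"] by (simp add: e1x br_basis bil algebra_simps)
    thus "br (\<psi> (e 1) (e 1)) x = scale (of_nat 2) (\<psi> (e 1) (e 1))"
      by (simp add: scale_two)
  qed simp
  have xe1: "\<psi> x (e 1) = 0"
  proof (rule tail_eigenvector_zero)
    show "in_tail (\<psi> x (e 1))"
      using in_tail by (simp add: \<psi>_def cob_def d_simps br_basis)
    thus "br (\<psi> x (e 1)) x = scale (of_nat 1) (\<psi> x (e 1))"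
      using ZL2_x_e1[OF \<psi>, of x] by (simp add: xx e1x zero' br_basis bil)
  qed simp
  have "\<psi> (e i) (e 1) = 0 \<and> \<psi> (e i) x = 0" if "1 \<le> i" "i \<le> n" for i
    using that zero'[of i] e1e1 e1x by (cases "i = 1") auto
  hence "\<psi> u (e 1) = 0 \<and> \<psi> u x = 0" for u
    by (induction u rule: basis_induct) (use xe1 xx in \<open>auto simp: bil\<close>)
  hence "\<psi> u v = 0" for u v
    by (subst bilinear_tail_eq[OF ZL2_bilinear[OF \<psi>]]) (use tail' in auto)
  thus ?thesis using d(1) by (auto simp: \<psi>_def fun_eq_iff)
qed

end

section \<open>The cocycle \<open>\<xi>\<close> and its nontriviality\<close>

locale algebra_R3_cocycle = algebra_R3_ge3 scale br n e x
  for scale :: "complex \<Rightarrow> 'v::ab_group_add \<Rightarrow> 'v" and br n e x +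
  fixes \<xi> :: "'v \<Rightarrow> 'v \<Rightarrow> 'v"
  assumes bilinear_xi: "bilinear_map scale \<xi>"
    and xi_e_e: "\<And>i j. i \<in> {1..n} \<Longrightarrow> j \<in> {1..n} \<Longrightarrow> \<xi> (e i) (e j) = 0"
    and xi_e1_x: "\<xi> (e 1) x = e 1"
    and xi_ei_x: "\<And>i. i \<in> {2..n} \<Longrightarrow> \<xi> (e i) x = scale (of_nat i - 2) (e i)"
    and xi_x_e1: "\<xi> x (e 1) = - e 1"
    and xi_x_ei: "\<And>i. i \<in> {2..n} \<Longrightarrow> \<xi> x (e i) = 0"
    and xi_x_x: "\<xi> x x = 0"
begin

lemmas xi_bilinear = bilinear_simps[OF bilinear_xi]

lemma xi_tail [simp]: "2 \<le> i \<Longrightarrow> i \<le> n \<Longrightarrow> \<xi> u (e i) = 0"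
  by (induction u rule: basis_induct) (auto simp: xi_bilinear xi_e_e xi_x_ei)

lemma co_xi_e1 [simp]: "j \<le> n \<Longrightarrow> co j (\<xi> u (e 1)) = (if j = 1 then - co 0 u else 0)"
  by (induction u rule: basis_induct) (auto simp: xi_bilinear xi_e_e xi_x_e1)

lemma co_xi_x [simp]:
  "j \<le> n \<Longrightarrow> co j (\<xi> u x) =
    (if j = 0 then 0 else if j = 1 then co 1 u else (of_nat j - 2) * co j u)"
proof (induction u rule: basis_induct)
  case (2 i)
  then show ?case using xi_e1_x xi_ei_x[of i] by (cases "i = 1") auto
qed (auto simp: xi_bilinear xi_x_x algebra_simps)

lemma co_xi:
  "j \<le> n \<Longrightarrow> co j (\<xi> u v) = co 1 v * (if j = 1 then - co 0 u else 0) +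
    co 0 v * (if j = 0 then 0 else if j = 1 then co 1 u else (of_nat j - 2) * co j u)"
  by (subst bilinear_tail_eq[OF bilinear_xi]) simp_all

lemma xi_ZL2: "\<xi> \<in> ZL2 scale br"
proof -
  have "br u (\<xi> v w) - br (\<xi> u v) w + br (\<xi> u w) v
    + \<xi> u (br v w) - \<xi> (br u v) w + \<xi> (br u w) v = 0" (is "?L = 0") for u v w
  proof (rule vec_eqI)
    fix j assume j: "j \<le> n"
    consider "j = 0" | "j = 1" | "j = 2" | "3 \<le> j" by linarith
    thus "co j ?L = co j 0"
      using j by cases (auto simp: co_br co_xi of_nat_diff algebra_simps)
  qed
  thus ?thesis using bilinear_xi by (simp add: ZL2_def)
qed

lemma xi_notin_BL2: "\<xi> \<notin> BL2 scale br"
proof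
  assume "\<xi> \<in> BL2 scale br"
  then obtain d where d: "Vector_Spaces.linear scale scale d" and xi: "\<xi> = cob d"
    by (auto simp: BL2_iff)
  \<comment> \<open>Both coordinates of the coboundary equal \<open>co 0 (d (e n))\<close>,
    contributed by \<open>br x x = e n\<close>, whereas \<open>\<xi>\<close> gives \<open>0\<close>
    and \<open>n - 2\<close>.\<close>
  have "co n (\<xi> x (e n)) = co n (cob d x (e n))" "co n (\<xi> (e n) x) = co n (cob d (e n) x)"
    by (simp_all add: xi)
  thus False using n3
    by (auto simp: cob_def xi_x_ei br_e_x co_br linear_simps[OF d])
qed

section \<open>Reduction of an arbitrary cocycle to a multiple of \<open>\<xi>\<close>\<close>

definition xi_trivial :: "('v \<Rightarrow> 'v \<Rightarrow> 'v) \<Rightarrow> bool" where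
  "xi_trivial \<phi> \<longleftrightarrow> (\<exists>d c. Vector_Spaces.linear scale scale d \<and>
    \<phi> = (\<lambda>u v. cob d u v + scale c (\<xi> u v)))"

lemma xi_trivialI:
  assumes "Vector_Spaces.linear scale scale d" "xi_trivial (\<lambda>u v. \<phi> u v - cob d u v)"
  shows "xi_trivial \<phi>"
proof -
  obtain d' c where d': "Vector_Spaces.linear scale scale d'"
    and eq: "\<And>u v. \<phi> u v - cob d u v = cob d' u v + scale c (\<xi> u v)"
    using assms(2) by (auto simp: xi_trivial_def fun_eq_iff)
  have "\<phi> u v = cob (\<lambda>u. d u + d' u) u v + scale c (\<xi> u v)" for u v
    using eq[of u v] by (simp add: cob_def br_bilinear algebra_simps)
  moreover have "Vector_Spaces.linear scale scale (\<lambda>u. d u + d' u)"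
    using assms(1) d' by (simp add: linear_iff' scale_right_distrib algebra_simps)
  ultimately show ?thesis by (auto simp: xi_trivial_def fun_eq_iff)
qed

lemma xi_trivial_scalar_on_tail:
  assumes \<phi>: "\<phi> \<in> ZL2 scale br" and tail: "\<And>u i. 2 \<le> i \<Longrightarrow> i \<le> n \<Longrightarrow> \<phi> u (e i) = 0"
    and e1: "\<And>i. 2 \<le> i \<Longrightarrow> i \<le> n \<Longrightarrow> \<phi> (e i) (e 1) = 0"
    and x: "\<And>i. 2 \<le> i \<Longrightarrow> i \<le> n \<Longrightarrow> \<phi> (e i) x = scale c (e i)"
    and in_tail: "in_tail (\<phi> (e 1) (e 1))" "in_tail (\<phi> (e 1) x)"
      "in_tail (\<phi> x (e 1))" "in_tail (\<phi> x x)"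
  shows "xi_trivial \<phi>"
proof -
  define k where "k = c / (of_nat n - 2)"
  obtain d where d: "Vector_Spaces.linear scale scale d" "d x = scale (- k) x"
    "\<And>i. 1 \<le> i \<Longrightarrow> i \<le> n \<Longrightarrow> d (e i) = (if i = 1 then 0 else scale (- 2 * k) (e i))"
    using obtain_linear[of "scale (- k) x" "\<lambda>i. if i = 1 then 0 else scale (- 2 * k) (e i)"] by blast
  note d_simps = d linear_simps[OF d(1)]
  \<comment> \<open>\<open>\<xi>\<close> is cohomologous to the cocycle that sends \<open>(e i, x)\<close> to \<open>(n - 2) e i\<close> for \<open>i \<ge> 2\<close>
    and all other pairs of basis vectors to \<open>0\<close>; up to the factor \<open>- k\<close> this \<open>d\<close> realises it.\<close>
  define \<psi> where "\<psi> u v = \<phi> u v - cob d u v - scale k (\<xi> u v)" for u v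
  have "\<psi> \<in> ZL2 scale br"
    unfolding \<psi>_def using \<phi> d(1) xi_ZL2 by (intro ZL2_diff cob_ZL2 ZL2_scale)
  moreover have "\<psi> u (e i) = 0" if "2 \<le> i" "i \<le> n" for u i
    using that tail[OF that] by (simp add: \<psi>_def cob_def d_simps br_bilinear)
  moreover have "\<psi> (e i) (e 1) = 0" if "2 \<le> i" "i \<le> n" for i
    using that e1[OF that] xi_e_e[of i 1] by (auto simp: \<psi>_def cob_def d_simps br_basis)
  moreover have "\<psi> (e i) x = 0" if "2 \<le> i" "i \<le> n" for i
  proof -
    \<comment> \<open>Subtracting the coboundary contributes \<open>k * (i - n)\<close>, subtracting
      the multiple of \<open>\<xi>\<close> contributes \<open>- k * (i - 2)\<close>; the sum is
      independent of \<open>i\<close>, and \<open>k\<close> makes it cancel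
      \<open>c\<close>.\<close>
    have "\<psi> (e i) x = scale (c - k * (of_nat n - 2)) (e i)"
    proof (rule vec_eqI)
      fix j assume "j \<le> n"
      thus "co j (\<psi> (e i) x) = co j (scale (c - k * (of_nat n - 2)) (e i))"
        using that by (simp add: \<psi>_def cob_def d_simps br_basis x xi_ei_x del: scale_left_diff_distrib)
          (simp add: algebra_simps)
    qed
    thus ?thesis by (simp add: k_def)
  qed
  moreover have "in_tail (\<psi> (e 1) (e 1))" "in_tail (\<psi> (e 1) x)"
      "in_tail (\<psi> x (e 1))" "in_tail (\<psi> x x)"
    using in_tail
    by (simp_all add: \<psi>_def cob_def d_simps br_basis xi_x_x xi_x_e1 xi_e1_x xi_e_e)
  ultimately obtain d' where d': "Vector_Spaces.linear scale scale d'" "\<psi> = cob d'"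
    using coboundary_of_zero_on_tail[of \<psi>] by blast
  have "(\<lambda>u v. \<phi> u v - cob d u v) = (\<lambda>u v. cob d' u v + scale k (\<xi> u v))"
    using d'(2) by (auto simp: fun_eq_iff \<psi>_def algebra_simps)
  hence "xi_trivial (\<lambda>u v. \<phi> u v - cob d u v)" using d'(1) by (auto simp: xi_trivial_def)
  with d(1) show ?thesis by (rule xi_trivialI)
qed

text \<open>The correction \<open>d\<close> is chosen at \<open>e 2\<close> and then forced along
  the chain by making \<open>p\<close> vanish there; the relation between \<open>p\<close> and
  \<open>q\<close> then carries the scalar found at \<open>e 2\<close> up the chain.\<close>

lemma xi_trivial_tail_valued:
  assumes \<phi>: "\<phi> \<in> ZL2 scale br" and tail: "\<And>u i. 2 \<le> i \<Longrightarrow> i \<le> n \<Longrightarrow> \<phi> u (e i) = 0"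
    and in_tail: "\<And>u. in_tail (\<phi> u (e 1))" "\<And>u. in_tail (\<phi> u x)"
  shows "xi_trivial \<phi>"
proof -
  \<comment> \<open>This is the later \<open>d (e 2)\<close>. On the tail,
    \<open>br y x - scale (2 - of_nat n) y\<close> multiplies coordinate \<open>j\<close> by
    \<open>j - 2\<close>, so only the \<open>e 2\<close> coordinate of \<open>\<phi> (e 2) x\<close>
    survives, as \<open>c\<close>.\<close>
  obtain y where y: "\<And>j. j \<le> n \<Longrightarrow> co j y = (if j < 3 then 0 else co j (\<phi> (e 2) x) / (of_nat j - 2))"
    using ex_vec[of "\<lambda>j. if j < 3 then 0 else co j (\<phi> (e 2) x) / (of_nat j - 2)"] by blast
  \<comment> \<open>\<open>g k\<close> becomes \<open>d (e (k + 2))\<close>; the recursion is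
    \<open>cob d (e i) (e 1) = \<phi> (e i) (e 1)\<close> solved for
    \<open>d (e (i + 1))\<close>.\<close>
  define g where "g = rec_nat y (\<lambda>k w. br w (e 1) - \<phi> (e (k + 2)) (e 1))"
  have g: "g 0 = y" "g (Suc k) = br (g k) (e 1) - \<phi> (e (k + 2)) (e 1)" for k
    by (simp_all add: g_def)
  have "in_tail y" using y by (auto simp: in_tail_def)
  hence g_tail: "in_tail (g k)" for k
    by (induction k) (auto simp: g in_tail)
  obtain d where d: "Vector_Spaces.linear scale scale d" "d x = 0"
    "\<And>i. 1 \<le> i \<Longrightarrow> i \<le> n \<Longrightarrow> d (e i) = (if i = 1 then 0 else g (i - 2))"
    using obtain_linear[of 0 "\<lambda>i. if i = 1 then 0 else g (i - 2)"] by blast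
  note d_simps = d linear_simps[OF d(1)]
  define \<psi> where "\<psi> u v = \<phi> u v - cob d u v" for u v
  have \<psi>: "\<psi> \<in> ZL2 scale br"
    unfolding \<psi>_def using \<phi> cob_ZL2[OF d(1)] by (rule ZL2_diff)
  note bil = bilinear_simps[OF ZL2_bilinear[OF \<psi>]]
  have tail': "\<psi> u (e i) = 0" if "2 \<le> i" "i \<le> n" for u i
    using that tail[OF that] g_tail by (simp add: \<psi>_def cob_def d_simps br_bilinear)
  have basic: "in_tail (\<psi> (e 1) (e 1))" "in_tail (\<psi> (e 1) x)" "in_tail (\<psi> x (e 1))" "in_tail (\<psi> x x)"
    using in_tail g_tail by (simp_all add: \<psi>_def cob_def d_simps br_basis)
  have e1: "\<psi> (e i) (e 1) = 0" if "2 \<le> i" "i < n" for i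
  proof -
    have i: "Suc (i - 2) = i - 1" "i - 2 + 2 = i" using that by auto
    have "g (i - 1) = br (g (i - 2)) (e 1) - \<phi> (e i) (e 1)"
      using g(2)[of "i - 2"] by (simp only: i)
    moreover have "i + 1 - 2 = i - 1" by simp
    hence "d (e (i + 1)) = g (i - 1)" using that by (simp only: d(3)) simp
    ultimately show ?thesis using that by (simp add: \<psi>_def cob_def d(2) d(3)[of i] d(3)[of 1] br_basis)
  qed
  define c where "c = co 2 (\<phi> (e 2) x)"
  have e2x: "\<psi> (e 2) x = scale c (e 2)"
  proof (rule vec_eqI)
    fix j assume j: "j \<le> n"
    have nonzero: "(of_nat j :: complex) \<noteq> 2" if "3 \<le> j"
      using that of_nat_eq_iff[where 'a = complex, of j 2] by auto
    have *: "\<psi> (e 2) x = \<phi> (e 2) x - (br y x - scale (2 - of_nat n) y)"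
      by (simp add: \<psi>_def cob_def d_simps br_basis g)
    consider "j = 0" | "j = 1" | "j = 2" | "3 \<le> j" by linarith
    thus "co j (\<psi> (e 2) x) = co j (scale c (e 2))"
    proof cases
      case 4
      have "co j (\<psi> (e 2) x) = co j (\<phi> (e 2) x) - (of_nat j - 2) * co j y"
        using 4 j by (simp add: * co_br y[of 0] algebra_simps)
      thus ?thesis using 4 j nonzero by (simp add: y)
    qed (use j in_tail in \<open>auto simp: * co_br y c_def in_tail_def\<close>)
  qed
  \<comment> \<open>For \<open>i < n\<close> the relation at \<open>e i\<close> reduces to
    \<open>\<psi> (e (i + 1)) x = br (\<psi> (e i) x) (e 1)\<close>.\<close>
  have ex: "\<psi> (e i) x = scale c (e i)" if "2 \<le> i" "i \<le> n" for i
    using that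
  proof (induction i rule: dec_induct)
    case (step i)
    thus ?case using ZL2_x_e1[OF \<psi>, of "e i"] basic(3) e1[of i]
      by (simp add: br_basis bil flip: Suc_eq_plus1)
  qed (use e2x in simp)
  \<comment> \<open>The recursion does not reach this value; the relation at \<open>e n\<close>
    makes it an eigenvector for the eigenvalue 1.\<close>
  have "in_tail (\<psi> (e n) (e 1))"
    using in_tail g_tail by (simp add: \<psi>_def cob_def d_simps br_basis)
  moreover have "br (\<psi> (e n) (e 1)) x = scale (of_nat 1) (\<psi> (e n) (e 1))"
    using ZL2_x_e1[OF \<psi>, of "e n"] basic(3) ex[of n] by (simp add: br_basis bil)
  ultimately have "\<psi> (e n) (e 1) = 0" by (rule tail_eigenvector_zero) simp
  with e1 have "\<psi> (e i) (e 1) = 0" if "2 \<le> i" "i \<le> n" for i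
    using that by (cases "i = n") auto
  hence "xi_trivial \<psi>" using \<psi> tail' ex basic by (intro xi_trivial_scalar_on_tail)
  with d(1) show ?thesis unfolding \<psi>_def by (rule xi_trivialI)
qed

text \<open>One correction at \<open>(x, e 1)\<close> is enough: polarisation forces all remaining
  values into the tail.\<close>

lemma xi_trivial_vanishing_on_tail:
  assumes \<phi>: "\<phi> \<in> ZL2 scale br" and tail: "\<And>u i. 2 \<le> i \<Longrightarrow> i \<le> n \<Longrightarrow> \<phi> u (e i) = 0"
  shows "xi_trivial \<phi>"
proof -
  define s where "s = \<phi> x (e 1)"
  \<comment> \<open>At \<open>(x, e 1)\<close> the coboundary of \<open>d\<close> agrees with
    \<open>s\<close> in the coordinates of \<open>x\<close> and \<open>e 1\<close>.\<close>
  obtain d where d: "Vector_Spaces.linear scale scale d" "d x = scale (- co 1 s) x"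
    "\<And>i. 1 \<le> i \<Longrightarrow> i \<le> n \<Longrightarrow> d (e i) = (if i = 1 then scale (co 0 s) x else 0)"
    using obtain_linear[of "scale (- co 1 s) x" "\<lambda>i. if i = 1 then scale (co 0 s) x else 0"] by blast
  note d_simps = d linear_simps[OF d(1)]
  define \<psi> where "\<psi> u v = \<phi> u v - cob d u v" for u v
  have \<psi>: "\<psi> \<in> ZL2 scale br"
    unfolding \<psi>_def using \<phi> cob_ZL2[OF d(1)] by (rule ZL2_diff)
  note bil = bilinear_simps[OF ZL2_bilinear[OF \<psi>]]
  have tail': "\<psi> u (e i) = 0" if "2 \<le> i" "i \<le> n" for u i
    using that tail[OF that] by (simp add: \<psi>_def cob_def d_simps br_bilinear)
  have sym: "in_tail (\<psi> v w + \<psi> w v)" if "in_tail (br v w + br w v)" for v w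
  proof -
    have "\<psi> u (br v w + br w v) = 0" for u
      by (subst bilinear_tail_eq[OF ZL2_bilinear[OF \<psi>]]) (use tail' that in \<open>auto simp: in_tail_def\<close>)
    thus ?thesis using ZL2_polarized[OF \<psi>, of _ v w] by (simp add: in_tail_iff)
  qed
  have xe1: "in_tail (\<psi> x (e 1))"
    by (simp add: \<psi>_def cob_def d_simps br_basis s_def[symmetric] in_tail_def)
  have e1x: "in_tail (\<psi> (e 1) x)"
    using sym[of "e 1" x] xe1 by (simp add: in_tail_def)
  have diag: "in_tail (\<psi> (e 1) (e 1))" "in_tail (\<psi> x x)"
    using sym[of "e 1" "e 1"] sym[of x x] by (simp_all add: br_basis in_tail_def)
  \<comment> \<open>For \<open>i \<ge> 2\<close> the swapped term of the symmetrised value has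
    second argument \<open>e i\<close> and vanishes.\<close>
  have ei: "in_tail (\<psi> (e i) (e 1)) \<and> in_tail (\<psi> (e i) x)" if "1 \<le> i" "i \<le> n" for i
    using that sym[of "e i" "e 1"] sym[of "e i" x] tail'[of i] diag e1x
    by (cases "i = 1") (auto simp: br_basis)
  have "in_tail (\<psi> u (e 1)) \<and> in_tail (\<psi> u x)" for u
    by (induction u rule: basis_induct) (use ei xe1 diag in \<open>auto simp: bil\<close>)
  hence "xi_trivial \<psi>" using \<psi> tail' by (intro xi_trivial_tail_valued) auto
  with d(1) show ?thesis unfolding \<psi>_def by (rule xi_trivialI)
qed

text \<open>Each \<open>e i\<close> with \<open>i \<ge> 2\<close> is a multiple of a symmetrised
  bracket: \<open>br x x = e n\<close>, and \<open>br (e i) x + br x (e i)\<close> is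
  \<open>(i - n)\<close> times \<open>e i\<close>. Polarisation thus turns
  \<open>\<phi> u (e i)\<close> into \<open>br u (g i)\<close>.\<close>

lemma ZL2_xi_trivial:
  assumes \<phi>: "\<phi> \<in> ZL2 scale br"
  shows "xi_trivial \<phi>"
proof -
  note bil = bilinear_simps[OF ZL2_bilinear[OF \<phi>]]
  \<comment> \<open>The divisor \<open>i - n\<close> vanishes at \<open>i = n\<close>, where
    \<open>br x x\<close> is used instead.\<close>
  define g where "g i = (if i = n then - \<phi> x x
    else scale (- 1 / (of_nat i - of_nat n)) (\<phi> (e i) x + \<phi> x (e i)))" for i
  have g: "\<phi> u (e i) = br u (g i)" if "2 \<le> i" "i \<le> n" for u i
  proof (cases "i = n")
    case True
    have "scale 2 (br u (\<phi> x x) + \<phi> u (e n)) = 0"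
      using ZL2_polarized[OF \<phi>, of u x x]
      by (simp add: br_basis bil scale_two add_ac)
    hence "\<phi> u (e n) = - br u (\<phi> x x)" by (simp add: eq_neg_iff_add_eq_0 add.commute)
    with True show ?thesis by (simp add: g_def br_bilinear)
  next
    case False
    define k :: complex where "k = of_nat i - of_nat n"
    have "k \<noteq> 0" using False by (simp add: k_def)
    have "br u (\<phi> (e i) x + \<phi> x (e i)) + scale k (\<phi> u (e i)) = 0"
      using ZL2_polarized[OF \<phi>, of u "e i" x] that by (simp add: br_basis bil k_def)
    hence "scale (- 1 / k) (br u (\<phi> (e i) x + \<phi> x (e i))) = scale (- 1 / k) (- scale k (\<phi> u (e i)))"
      by (simp add: add_eq_0_iff2)
    with \<open>k \<noteq> 0\<close> False show ?thesis by (simp add: g_def br_bilinear flip: k_def)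
  qed
  obtain d where d: "Vector_Spaces.linear scale scale d" "d x = 0"
    "\<And>i. 1 \<le> i \<Longrightarrow> i \<le> n \<Longrightarrow> d (e i) = (if i = 1 then 0 else g i)"
    using obtain_linear[of 0 "\<lambda>i. if i = 1 then 0 else g i"] by blast
  \<comment> \<open>Since right multiplication by \<open>e i\<close> is zero,
    \<open>cob d u (e i)\<close> is just \<open>br u (g i)\<close>.\<close>
  have "\<phi> u (e i) - cob d u (e i) = 0" if "2 \<le> i" "i \<le> n" for u i
    using that g[OF that] by (simp add: cob_def d linear_simps[OF d(1)])
  hence "xi_trivial (\<lambda>u v. \<phi> u v - cob d u v)"
    using ZL2_diff[OF \<phi> cob_ZL2[OF d(1)]] by (intro xi_trivial_vanishing_on_tail)
  with d(1) show ?thesis by (rule xi_trivialI)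
qed

section \<open>Passage to the quotient\<close>

lemma HL2_basis: "vectorspace.basis class_ring (HL2 scale br) {HL2_class scale br \<xi>}"
proof -
  interpret L: leibniz_algebra scale br by (rule leibniz_algebra_R3) simp
  interpret Z: Module.module class_ring "ZL2_module scale br" by (rule L.module_ZL2)
  interpret B: abelian_subgroup "BL2 scale br" "ZL2_module scale br"
    by (intro abelian_subgroupI3 additive_subgroup.intro
        Module.submodule.axioms(1)[OF L.submodule_BL2]) (rule Z.M.abelian_group_axioms)
  have xi: "\<xi> \<in> carrier (ZL2_module scale br)" using xi_ZL2 by (simp add: ZL2_module_def)
  show ?thesis
  proof (rule vectorspace.basis_singletonI[OF L.vectorspace_HL2])
    show "HL2_class scale br \<xi> \<in> carrier (HL2 scale br)"
      using xi by (auto simp: HL2_def quotient_module_def HL2_class_def A_RCOSETS_def')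
    \<comment> \<open>The zero class is \<open>BL2 scale br\<close> itself, which does not contain
      \<open>\<xi>\<close>.\<close>
    have "\<xi> \<in> HL2_class scale br \<xi>"
      unfolding HL2_class_def using xi by (rule B.a_rcos_self)
    thus "HL2_class scale br \<xi> \<noteq> \<zero>\<^bsub>HL2 scale br\<^esub>"
      using xi_notin_BL2 by (auto simp: HL2_def quotient_module_def)
  next
    fix X assume "X \<in> carrier (HL2 scale br)"
    then obtain \<phi> where \<phi>: "\<phi> \<in> ZL2 scale br" and X: "X = BL2 scale br +>\<^bsub>ZL2_module scale br\<^esub> \<phi>"
      by (auto simp: HL2_def quotient_module_def A_RCOSETS_def' ZL2_module_def)
    obtain d c where d: "Vector_Spaces.linear scale scale d"
      and eq: "\<phi> = (\<lambda>u v. cob d u v + scale c (\<xi> u v))"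
      using ZL2_xi_trivial[OF \<phi>] by (auto simp: xi_trivial_def)
    have "\<phi> \<in> BL2 scale br +>\<^bsub>ZL2_module scale br\<^esub> (c \<odot>\<^bsub>ZL2_module scale br\<^esub> \<xi>)"
      unfolding a_r_coset_def' using d eq
      by (auto simp: BL2_iff ZL2_module_def CL2_def intro!: bexI[of _ "cob d"])
    hence "X = BL2 scale br +>\<^bsub>ZL2_module scale br\<^esub> (c \<odot>\<^bsub>ZL2_module scale br\<^esub> \<xi>)"
      unfolding X using xi by (intro B.a_repr_independence'[symmetric]) auto
    also have "\<dots> = c \<odot>\<^bsub>HL2 scale br\<^esub> HL2_class scale br \<xi>"
      using Z.quotient_smult[OF L.submodule_BL2 _ xi, of c]
      by (simp add: HL2_def quotient_module_def HL2_class_def)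
    finally show "\<exists>c\<in>carrier class_ring. X = c \<odot>\<^bsub>HL2 scale br\<^esub> HL2_class scale br \<xi>"
      by auto
  qed
qed

end

theorem proposition3p10:
  fixes scale :: "complex \<Rightarrow> 'v::ab_group_add \<Rightarrow> 'v"
    and br :: "'v \<Rightarrow> 'v \<Rightarrow> 'v" and n :: nat and e :: "nat \<Rightarrow> 'v" and x :: 'v
    and \<xi> :: "'v \<Rightarrow> 'v \<Rightarrow> 'v"
  assumes n: "3 \<le> n"
    and R3: "algebra_R3 scale br n e x"
    and bilinear_xi: "bilinear_map scale \<xi>"
    and xi_e_e: "\<And>i j. i \<in> {1..n} \<Longrightarrow> j \<in> {1..n} \<Longrightarrow> \<xi> (e i) (e j) = 0"
    and xi_e1_x: "\<xi> (e 1) x = e 1"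
    and xi_e2_x: "\<xi> (e 2) x = 0"
    and xi_ei_x: "\<And>i. i \<in> {3..n} \<Longrightarrow> \<xi> (e i) x = scale (of_nat i - 2) (e i)"
    and xi_x_e1: "\<xi> x (e 1) = - e 1"
    and xi_x_ei: "\<And>i. i \<in> {2..n} \<Longrightarrow> \<xi> x (e i) = 0"
    and xi_x_x: "\<xi> x x = 0"
  shows "vectorspace.basis class_ring (HL2 scale br) {HL2_class scale br \<xi>}"
proof -
  interpret algebra_R3 scale br n e x by (rule R3)
  \<comment> \<open>The factor vanishes at \<open>i = 2\<close>, so the value at
    \<open>(e 2, x)\<close> fits the same formula.\<close>
  have xi_ei_x': "\<xi> (e i) x = scale (of_nat i - 2) (e i)" if "i \<in> {2..n}" for i
    using that xi_e2_x xi_ei_x[of i] by (cases "i = 2") auto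
  interpret algebra_R3_cocycle scale br n e x \<xi>
    by unfold_locales (use n bilinear_xi xi_e_e xi_e1_x xi_ei_x' xi_x_e1 xi_x_ei xi_x_x in auto)
  show ?thesis by (rule HL2_basis)
qed

end
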